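(* The tableau calculus $\mathbf{TAB}_{\mathbf{PO}}$ is complete for the class of all partially ordered (PO) models; that is, every formula $\varphi$ that is true at every world of every PO model is provable in $\mathbf{TAB}_{\mathbf{PO}}$.
   Context: **Formulas.** Let $\mathbf{Prop}$ (propositional variables) and $\mathbf{Nom}$ (nominals) be disjoint countably infinite sets. Formulas are $\varphi ::= p \mid i \mid \neg\varphi \mid \varphi\land\varphi \mid \varphi\lor\varphi \mid \Diamond\varphi \mid \Box\varphi \mid @_i\varphi$ with $p\in\mathbf{Prop}$, $i\in\mathbf{Nom}$. All formulas are taken in negation normal form (NNF: negation only in front of propositional variables and nominals; $\neg @_i\varphi$ is rewritten as $@_i\neg\varphi$, Boolean and modal operators as usual), and $\neg\varphi$ denotes the NNF of the negation of $\varphi$. **Semantics.** A model $\mathcal M=(W,R,V)$ has a non-empty set $W$, a binary relation $R$ on $W$, and $V:\mathbf{Prop}\cup\mathbf{Nom}\to\mathcal P(W)$ with $V(i)=\{i^V\}$ a singleton for each $i\in\mathbf{Nom}$. Satisfaction: $\mathcal M,w\models p$ iff $w\in V(p)$; $\mathcal M,w\models i$ iff $w=i^V$; Boolean connectives as usual; $\mathcal M,w\models\Diamond\varphi$ iff $\mathcal M,v\models\varphi$ for some $v$ with $wRv$; $\mathcal M,w\models\Box\varphi$ iff $\mathcal M,v\models\varphi$ for all $v$ with $wRv$; $\mathcal M,w\models@_i\varphi$ iff $\mathcal M,i^V\models\varphi$. A PO model is a model whose $R$ is reflexive, anti-symmetric and transitive. **Tableaus.** A tableau is a tree of formulas, built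 downwards from a root formula $@_i\varphi$, where $i\in\mathbf{Nom}$ does not occur in $\varphi$, by extending branches with the rules below (branches may a priori be infinite). We write $\varphi\in\Theta$ if $\varphi$ occurs in the branch $\Theta$. A branch $\Theta$ is closed if $@_i\varphi, @_i\neg\varphi\in\Theta$ for some $\varphi$, $i$; otherwise it is open. A tableau is closed if all its branches are closed. A closed branch is not extended, nor is a branch on which every formula that could be generated by applying a rule already exists; rules are not applied redundantly: each application must add a formula not already on the branch to every branch it produces. A formula $\varphi$ is provable if there is a closed tableau with root formula $@_i\neg\varphi$, where $i\in\mathbf{Nom}$ does not occur in $\varphi$. **Rules of $\mathbf{TAB}_{\mathbf{PO}}$** (premises are on the branch; conclusions are added to it). "Accessibility formula" means a formula $@_i\Diamond j$ added by $[\Diamond]$ (with $j$ new) or a formula $@_i\Diamond i$ added by $[Ref]$. - $[Eq]$: add $@_i i$, for any nominal $i$ already occurring in the branch. - $[\land]$: from $@_i(\varphi\land\psi)$ add $@_i\varphi$ and $@_i\psi$. - $[\lor]$: from $@_i(\varphi\lor\psi)$ split the branch, adding $@_i\varphi$ on one side and $@_i\psi$ on the other. - $[\Diamond]$: from $@_i\Diamond\varphi$ which is not an accessibility formula, add $@_i\Diamond j$ and $@_j\varphi$, where $j$ is a nominal not occurring in the branch; it is applied at most once per formula. - $[\Box]$: from $@_i\Box\varphi$ and $@_i\Diamond j$ add $@_j\varphi$. - $[@]$: from $@_i@_j\varphi$ add $@_j\varphi$. - $[Id]$: from $@_i\varphi$, not an accessibility formula, and $@_i j$ add $@_j\varphi$.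 - $[Ref]$: add $@_i\Diamond i$, for any nominal $i$ already occurring in the branch. - $[A\text{-}sym]$: add $@_i\Box(i\lor\Box\neg i)$, for any nominal $i$ already occurring in the branch. - $[Trs]$: from $@_i\Box\varphi$ and $@_i\Diamond j$ add $@_j\Box\varphi$. - Restriction $(\mathcal D)$: $[\Diamond]$ can be applied to $@_i\Diamond\varphi$ on a branch $\Theta$ only if $i$ is a quasi-urfather on $\Theta$ (at the moment of application). **Quasi-urfathers.** $@_i\varphi$ is a prefixed subformula of $@_j\psi$ if $\varphi$ is a subformula of $\psi$. For a nominal $i$ occurring in $\Theta$, $T^\Theta(i)=T_1^\Theta(i)\cup T_2^\Theta(i)$, where $T_1^\Theta(i)$ is the set of $\varphi$ such that $@_i\varphi\in\Theta$ is a prefixed subformula of the root formula of $\Theta$, and $T_2^\Theta(i)$ is the set of $\psi$ such that $@_i\psi\in\Theta$ is a prefixed subformula of $@_j\Box(j\lor\Box\neg j)$ for some $j$ occurring in the root formula. Nominals $i,j$ are twins in $\Theta$ if $T^\Theta(i)=T^\Theta(j)$. Write $i\prec_\Theta j$ if $j$ is introduced in $\Theta$ by applying $[\Diamond]$ to some $@_i\Diamond\varphi$; $\prec_\Theta^*$ is the reflexive transitive closure. A nominal $i$ is a quasi-urfather on $\Theta$ if there are no twins $j\neq k$ with $j\prec_\Theta^* i$ and $k\prec_\Theta^* i$. *)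

theory Defs
  imports "HOL-Library.Sublist"
begin

type_synonym pvar = nat
type_synonym nom = nat

datatype fm =
    Pro pvar
  | Nom nom
  | Neg fm
  | Con fm fm
  | Dis fm fm
  | Dia fm
  | Box fm
  | At nom fm

fun nnf :: "fm \<Rightarrow> fm" where
  "nnf (Pro p) = Pro p"
| "nnf (Nom i) = Nom i"
| "nnf (Con \<phi> \<psi>) = Con (nnf \<phi>) (nnf \<psi>)"
| "nnf (Dis \<phi> \<psi>) = Dis (nnf \<phi>) (nnf \<psi>)"
| "nnf (Dia \<phi>) = Dia (nnf \<phi>)"
| "nnf (Box \<phi>) = Box (nnf \<phi>)"
| "nnf (At i \<phi>) = At i (nnf \<phi>)"
| "nnf (Neg (Pro p)) = Neg (Pro p)"
| "nnf (Neg (Nom i)) = Neg (Nom i)"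
| "nnf (Neg (Neg \<phi>)) = nnf \<phi>"
| "nnf (Neg (Con \<phi> \<psi>)) = Dis (nnf (Neg \<phi>)) (nnf (Neg \<psi>))"
| "nnf (Neg (Dis \<phi> \<psi>)) = Con (nnf (Neg \<phi>)) (nnf (Neg \<psi>))"
| "nnf (Neg (Dia \<phi>)) = Box (nnf (Neg \<phi>))"
| "nnf (Neg (Box \<phi>)) = Dia (nnf (Neg \<phi>))"
| "nnf (Neg (At i \<phi>)) = At i (nnf (Neg \<phi>))"

text \<open>The type \<open>fm\<close> has unrestricted negation. Tableaus start from an NNF root, and the rules
  keep everything in NNF; there "\<open>\<not>\<phi>\<close>" is always \<open>nnf (Neg \<phi>)\<close>.\<close>

fun subfms :: "fm \<Rightarrow> fm set" where
  "subfms (Pro p) = {Pro p}"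
| "subfms (Nom i) = {Nom i}"
| "subfms (Neg \<phi>) = insert (Neg \<phi>) (subfms \<phi>)"
| "subfms (Con \<phi> \<psi>) = insert (Con \<phi> \<psi>) (subfms \<phi> \<union> subfms \<psi>)"
| "subfms (Dis \<phi> \<psi>) = insert (Dis \<phi> \<psi>) (subfms \<phi> \<union> subfms \<psi>)"
| "subfms (Dia \<phi>) = insert (Dia \<phi>) (subfms \<phi>)"
| "subfms (Box \<phi>) = insert (Box \<phi>) (subfms \<phi>)"
| "subfms (At i \<phi>) = insert (At i \<phi>) (subfms \<phi>)"

fun noms :: "fm \<Rightarrow> nom set" where
  "noms (Pro p) = {}"
| "noms (Nom i) = {i}"
| "noms (Neg \<phi>) = noms \<phi>"
| "noms (Con \<phi> \<psi>) = noms \<phi> \<union> noms \<psi>"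
| "noms (Dis \<phi> \<psi>) = noms \<phi> \<union> noms \<psi>"
| "noms (Dia \<phi>) = noms \<phi>"
| "noms (Box \<phi>) = noms \<phi>"
| "noms (At i \<phi>) = insert i (noms \<phi>)"


section \<open>Semantics\<close>

text \<open>The singleton value of a nominal \<open>i\<close> is given by its element \<open>den M i\<close>.\<close>

record 'w model =
  worlds :: "'w set"
  rel :: "('w \<times> 'w) set"
  val :: "pvar \<Rightarrow> 'w set"
  den :: "nom \<Rightarrow> 'w"

definition is_model :: "'w model \<Rightarrow> bool" where
  "is_model M \<longleftrightarrow> worlds M \<noteq> {} \<and> rel M \<subseteq> worlds M \<times> worlds M \<and>
     (\<forall>p. val M p \<subseteq> worlds M) \<and> (\<forall>i. den M i \<in> worlds M)"

fun sat :: "'w model \<Rightarrow> 'w \<Rightarrow> fm \<Rightarrow> bool" where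
  "sat M w (Pro p) \<longleftrightarrow> w \<in> val M p"
| "sat M w (Nom i) \<longleftrightarrow> w = den M i"
| "sat M w (Neg \<phi>) \<longleftrightarrow> \<not> sat M w \<phi>"
| "sat M w (Con \<phi> \<psi>) \<longleftrightarrow> sat M w \<phi> \<and> sat M w \<psi>"
| "sat M w (Dis \<phi> \<psi>) \<longleftrightarrow> sat M w \<phi> \<or> sat M w \<psi>"
| "sat M w (Dia \<phi>) \<longleftrightarrow> (\<exists>v. (w, v) \<in> rel M \<and> sat M v \<phi>)"
| "sat M w (Box \<phi>) \<longleftrightarrow> (\<forall>v. (w, v) \<in> rel M \<longrightarrow> sat M v \<phi>)"
| "sat M w (At i \<phi>) \<longleftrightarrow> sat M (den M i) \<phi>"

definition po_model :: "'w model \<Rightarrow> bool" where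
  "po_model M \<longleftrightarrow> is_model M \<and> partial_order_on (worlds M) (rel M)"

text \<open>Truth at every world of every PO model whose worlds are elements of the type \<open>'w\<close>.
  HOL cannot quantify over types inside a formula, so the ambient type is a parameter.\<close>

definition po_valid :: "'w itself \<Rightarrow> fm \<Rightarrow> bool" where
  "po_valid _ \<phi> \<longleftrightarrow> (\<forall>M :: 'w model. po_model M \<longrightarrow> (\<forall>w \<in> worlds M. sat M w \<phi>))"


section \<open>Branches\<close>

text \<open>A node below the root is a \<^emph>\<open>step\<close>: the list of all formulas that one rule application
  adds to the branch, together with the rule. \<open>DiaR i \<phi> j\<close> is the application of the diamond
  rule to \<open>At i (Dia \<phi>)\<close> that introduces \<open>j\<close>; \<open>RefR i\<close> adds \<open>At i (Dia (Nom i))\<close>.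
  A finite (initial segment of a) branch is the root formula \<open>\<rho>\<close> with the list \<open>\<Theta>\<close> of
  steps below it, in order of application.\<close>

datatype rule =
    EqR | ConR | DisR | DiaR nom fm nom | BoxR | AtR | IdR | RefR nom | AsymR | TrsR

type_synonym step = "rule \<times> fm list"

definition fms :: "fm \<Rightarrow> step list \<Rightarrow> fm set" where
  "fms \<rho> \<Theta> = insert \<rho> (\<Union>s \<in> set \<Theta>. set (snd s))"

definition bnoms :: "fm \<Rightarrow> step list \<Rightarrow> nom set" where
  "bnoms \<rho> \<Theta> = (\<Union>\<phi> \<in> fms \<rho> \<Theta>. noms \<phi>)"

definition rules :: "step list \<Rightarrow> rule set" where
  "rules \<Theta> = fst ` set \<Theta>"

text \<open>Being an accessibility formula depends on how the formula got onto the branch: the same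
  \<open>At i (Dia (Nom i))\<close> may also arise from the root formula.\<close>

definition accessibility :: "step list \<Rightarrow> fm \<Rightarrow> bool" where
  "accessibility \<Theta> \<chi> \<longleftrightarrow>
     (\<exists>i \<phi> j. DiaR i \<phi> j \<in> rules \<Theta> \<and> \<chi> = At i (Dia (Nom j))) \<or>
     (\<exists>i. RefR i \<in> rules \<Theta> \<and> \<chi> = At i (Dia (Nom i)))"

definition clash :: "fm set \<Rightarrow> bool" where
  "clash F \<longleftrightarrow> (\<exists>i \<phi>. At i \<phi> \<in> F \<and> At i (nnf (Neg \<phi>)) \<in> F)"

definition asym_fm :: "nom \<Rightarrow> fm" where
  "asym_fm i = Box (Dis (Nom i) (Box (Neg (Nom i))))"


section \<open>Quasi-urfathers\<close>

definition prefixed_subfm :: "fm \<Rightarrow> fm \<Rightarrow> bool" where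
  "prefixed_subfm \<alpha> \<beta> \<longleftrightarrow> (\<exists>i \<phi> j \<psi>. \<alpha> = At i \<phi> \<and> \<beta> = At j \<psi> \<and> \<phi> \<in> subfms \<psi>)"

definition T1 :: "fm \<Rightarrow> step list \<Rightarrow> nom \<Rightarrow> fm set" where
  "T1 \<rho> \<Theta> i = {\<phi>. At i \<phi> \<in> fms \<rho> \<Theta> \<and> prefixed_subfm (At i \<phi>) \<rho>}"

definition T2 :: "fm \<Rightarrow> step list \<Rightarrow> nom \<Rightarrow> fm set" where
  "T2 \<rho> \<Theta> i = {\<psi>. At i \<psi> \<in> fms \<rho> \<Theta> \<and>
     (\<exists>j \<in> noms \<rho>. prefixed_subfm (At i \<psi>) (At j (asym_fm j)))}"

definition Tset :: "fm \<Rightarrow> step list \<Rightarrow> nom \<Rightarrow> fm set" where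
  "Tset \<rho> \<Theta> i = T1 \<rho> \<Theta> i \<union> T2 \<rho> \<Theta> i"

definition twins :: "fm \<Rightarrow> step list \<Rightarrow> nom \<Rightarrow> nom \<Rightarrow> bool" where
  "twins \<rho> \<Theta> i j \<longleftrightarrow> i \<in> bnoms \<rho> \<Theta> \<and> j \<in> bnoms \<rho> \<Theta> \<and> Tset \<rho> \<Theta> i = Tset \<rho> \<Theta> j"

definition intro_rel :: "step list \<Rightarrow> (nom \<times> nom) set" where
  "intro_rel \<Theta> = {(i, j). \<exists>\<phi>. DiaR i \<phi> j \<in> rules \<Theta>}"

definition quasi_urfather :: "fm \<Rightarrow> step list \<Rightarrow> nom \<Rightarrow> bool" where
  "quasi_urfather \<rho> \<Theta> i \<longleftrightarrow> i \<in> bnoms \<rho> \<Theta> \<and>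
     \<not> (\<exists>j k. j \<noteq> k \<and> twins \<rho> \<Theta> j k \<and> (j, i) \<in> (intro_rel \<Theta>)\<^sup>* \<and> (k, i) \<in> (intro_rel \<Theta>)\<^sup>*)"


section \<open>Rules and tableaus\<close>

text \<open>\<open>applies \<rho> \<Theta> S\<close>: some rule is applicable at the end of \<open>\<Theta>\<close>, and \<open>S\<close> contains
  one step for each of the resulting branches.\<close>

text \<open>\<open>Dia\<close> includes restriction \<open>(\<D>)\<close>.\<close>

inductive applies :: "fm \<Rightarrow> step list \<Rightarrow> step set \<Rightarrow> bool" for \<rho> \<Theta> where
  Eq: "i \<in> bnoms \<rho> \<Theta> \<Longrightarrow> applies \<rho> \<Theta> {(EqR, [At i (Nom i)])}"
| Con: "At i (Con \<phi> \<psi>) \<in> fms \<rho> \<Theta> \<Longrightarrow> applies \<rho> \<Theta> {(ConR, [At i \<phi>, At i \<psi>])}"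
| Dis: "At i (Dis \<phi> \<psi>) \<in> fms \<rho> \<Theta> \<Longrightarrow> applies \<rho> \<Theta> {(DisR, [At i \<phi>]), (DisR, [At i \<psi>])}"
| Dia: "At i (Dia \<phi>) \<in> fms \<rho> \<Theta> \<Longrightarrow> \<not> accessibility \<Theta> (At i (Dia \<phi>)) \<Longrightarrow>
    (\<forall>k. DiaR i \<phi> k \<notin> rules \<Theta>) \<Longrightarrow> quasi_urfather \<rho> \<Theta> i \<Longrightarrow> j \<notin> bnoms \<rho> \<Theta> \<Longrightarrow>
    applies \<rho> \<Theta> {(DiaR i \<phi> j, [At i (Dia (Nom j)), At j \<phi>])}"
| Box: "At i (Box \<phi>) \<in> fms \<rho> \<Theta> \<Longrightarrow> At i (Dia (Nom j)) \<in> fms \<rho> \<Theta> \<Longrightarrow>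
    applies \<rho> \<Theta> {(BoxR, [At j \<phi>])}"
| At: "At i (At j \<phi>) \<in> fms \<rho> \<Theta> \<Longrightarrow> applies \<rho> \<Theta> {(AtR, [At j \<phi>])}"
| Id: "At i \<phi> \<in> fms \<rho> \<Theta> \<Longrightarrow> \<not> accessibility \<Theta> (At i \<phi>) \<Longrightarrow> At i (Nom j) \<in> fms \<rho> \<Theta> \<Longrightarrow>
    applies \<rho> \<Theta> {(IdR, [At j \<phi>])}"
| Ref: "i \<in> bnoms \<rho> \<Theta> \<Longrightarrow> applies \<rho> \<Theta> {(RefR i, [At i (Dia (Nom i))])}"
| Asym: "i \<in> bnoms \<rho> \<Theta> \<Longrightarrow> applies \<rho> \<Theta> {(AsymR, [At i (asym_fm i)])}"
| Trs: "At i (Box \<phi>) \<in> fms \<rho> \<Theta> \<Longrightarrow> At i (Dia (Nom j)) \<in> fms \<rho> \<Theta> \<Longrightarrow>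
    applies \<rho> \<Theta> {(TrsR, [At j (Box \<phi>)])}"

text \<open>Closed branches are not extended, and every resulting branch gets a new formula.\<close>

definition extends :: "fm \<Rightarrow> step list \<Rightarrow> step set \<Rightarrow> bool" where
  "extends \<rho> \<Theta> S \<longleftrightarrow> applies \<rho> \<Theta> S \<and> \<not> clash (fms \<rho> \<Theta>) \<and>
     (\<forall>s \<in> S. \<not> set (snd s) \<subseteq> fms \<rho> \<Theta>)"

text \<open>A tableau is a possibly infinite tree, given as the prefix-closed set of the step lists
  leading from the root \<open>[]\<close> (which carries \<open>\<rho>\<close>) to its nodes.\<close>

definition tableau :: "fm \<Rightarrow> step list set \<Rightarrow> bool" where
  "tableau \<rho> \<T> \<longleftrightarrow>
     (\<exists>i \<phi>. \<rho> = At i \<phi> \<and> i \<notin> noms \<phi>) \<and>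
     [] \<in> \<T> \<and>
     (\<forall>\<Theta> s. \<Theta> @ [s] \<in> \<T> \<longrightarrow> \<Theta> \<in> \<T>) \<and>
     (\<forall>\<Theta> \<in> \<T>. {s. \<Theta> @ [s] \<in> \<T>} = {} \<or> extends \<rho> \<Theta> {s. \<Theta> @ [s] \<in> \<T>})"

text \<open>The branches are the maximal chains of nodes; they may be infinite.\<close>

definition closed_tableau :: "fm \<Rightarrow> step list set \<Rightarrow> bool" where
  "closed_tableau \<rho> \<T> \<longleftrightarrow> tableau \<rho> \<T> \<and>
     (\<forall>B. pred_on.maxchain \<T> strict_prefix B \<longrightarrow> clash (\<Union>\<Theta> \<in> B. fms \<rho> \<Theta>))"

definition provable :: "fm \<Rightarrow> bool" where
  "provable \<phi> \<longleftrightarrow> (\<exists>i \<T>. i \<notin> noms \<phi> \<and> closed_tableau (At i (nnf (Neg \<phi>))) \<T>)"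

end

theory Submission
  imports Defs "HOL-Library.Countable_Set"
begin

text \<open>Restriction \<open>(\<D>)\<close> bounds the depth of the tree of introduced nominals, so every branch is
  finite, and applying rules as long as possible leaves either a closed tableau or a saturated open
  branch. In the latter case the sets \<open>T(i)\<close> of the quasi-urfathers \<open>i\<close> become a preorder, where
  \<open>t\<close> is below \<open>t'\<close> if every box of \<open>t\<close> is a box of \<open>t'\<close>. A diamond at a quasi-urfather is
  witnessed by a successor or by the twin of that successor. Owing to \<open>[A-sym]\<close>, types that contain
  a nominal form clusters of their own; all other clusters are unravelled into infinite
  ascending chains. The result is a countable PO model that refutes the formula.\<close>

section \<open>Negation normal form\<close>

fun is_nnf :: "fm \<Rightarrow> bool" where
  "is_nnf (Pro p) = True"
| "is_nnf (Nom i) = True"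
| "is_nnf (Neg \<phi>) = ((\<exists>p. \<phi> = Pro p) \<or> (\<exists>i. \<phi> = Nom i))"
| "is_nnf (Con \<phi> \<psi>) = (is_nnf \<phi> \<and> is_nnf \<psi>)"
| "is_nnf (Dis \<phi> \<psi>) = (is_nnf \<phi> \<and> is_nnf \<psi>)"
| "is_nnf (Dia \<phi>) = is_nnf \<phi>"
| "is_nnf (Box \<phi>) = is_nnf \<phi>"
| "is_nnf (At i \<phi>) = is_nnf \<phi>"

lemma is_nnf_nnf: "is_nnf (nnf \<phi>)"
  by (induction \<phi> rule: nnf.induct) auto

lemma noms_nnf: "noms (nnf \<phi>) = noms \<phi>"
  by (induction \<phi> rule: nnf.induct) auto

lemma sat_nnf: "sat M w (nnf \<phi>) \<longleftrightarrow> sat M w \<phi>"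
  by (induction \<phi> arbitrary: w rule: nnf.induct) auto

lemma finite_noms: "finite (noms \<phi>)"
  by (induction \<phi>) auto

lemma finite_subfms: "finite (subfms \<phi>)"
  by (induction \<phi>) auto

lemma subfms_refl: "\<phi> \<in> subfms \<phi>"
  by (cases \<phi>) auto

lemma subfms_trans: "\<phi> \<in> subfms \<psi> \<Longrightarrow> \<psi> \<in> subfms \<chi> \<Longrightarrow> \<phi> \<in> subfms \<chi>"
  by (induction \<chi>) auto

lemma noms_subfms: "\<phi> \<in> subfms \<psi> \<Longrightarrow> noms \<phi> \<subseteq> noms \<psi>"
  by (induction \<psi>) auto

lemma is_nnf_subfms: "\<phi> \<in> subfms \<psi> \<Longrightarrow> is_nnf \<psi> \<Longrightarrow> is_nnf \<phi>"
  by (induction \<psi>) auto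

lemma subfms_components:
  shows "Con \<phi> \<psi> \<in> subfms \<chi> \<Longrightarrow> \<phi> \<in> subfms \<chi> \<and> \<psi> \<in> subfms \<chi>"
    and "Dis \<phi> \<psi> \<in> subfms \<chi> \<Longrightarrow> \<phi> \<in> subfms \<chi> \<and> \<psi> \<in> subfms \<chi>"
    and "Dia \<phi> \<in> subfms \<chi> \<Longrightarrow> \<phi> \<in> subfms \<chi>"
    and "Box \<phi> \<in> subfms \<chi> \<Longrightarrow> \<phi> \<in> subfms \<chi>"
    and "At i \<phi> \<in> subfms \<chi> \<Longrightarrow> \<phi> \<in> subfms \<chi>"
  by (induction \<chi>) (auto simp: subfms_refl)

section \<open>Isomorphic copies of models\<close>

text \<open>Serves to move the refuting model, whose worlds are pairs of a type and a number, into
  the ambient type of \<open>po_valid\<close>.\<close>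

definition image_model :: "('v \<Rightarrow> 'w) \<Rightarrow> 'v model \<Rightarrow> 'w model" where
  "image_model f M = \<lparr>worlds = f ` worlds M, rel = map_prod f f ` rel M,
     val = (\<lambda>p. f ` val M p), den = (\<lambda>i. f (den M i))\<rparr>"

lemma rel_image_model:
  assumes "is_model M" "inj_on f (worlds M)" "w \<in> worlds M"
  shows "(f w, v') \<in> rel (image_model f M) \<longleftrightarrow> (\<exists>v. v' = f v \<and> (w, v) \<in> rel M)"
proof
  assume "(f w, v') \<in> rel (image_model f M)"
  then obtain u v where uv: "(u, v) \<in> rel M" "f u = f w" "v' = f v"
    by (auto simp: image_model_def)
  with assms have "u = w"
    by (auto simp: is_model_def dest: inj_onD)
  with uv show "\<exists>v. v' = f v \<and> (w, v) \<in> rel M" by blast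
qed (force simp: image_model_def)

lemma sat_image_model:
  assumes "is_model M" "inj_on f (worlds M)"
  shows "w \<in> worlds M \<Longrightarrow> sat (image_model f M) (f w) \<phi> \<longleftrightarrow> sat M w \<phi>"
proof (induction \<phi> arbitrary: w)
  case (Pro p)
  then show ?case
    using assms by (auto simp: image_model_def is_model_def dest: inj_onD)
next
  case (Nom i)
  then show ?case
    using assms by (auto simp: image_model_def is_model_def dest: inj_onD)
next
  case (At i \<phi>)
  then show ?case
    using assms(1) by (auto simp: image_model_def is_model_def)
next
  case (Dia \<phi>)
  have "v \<in> worlds M" if "(w, v) \<in> rel M" for v
    using assms(1) that by (auto simp: is_model_def)
  then show ?case
    using Dia.IH by (auto simp: rel_image_model[OF assms Dia.prems])
next
  case (Box \<phi>)
  have "v \<in> worlds M" if "(w, v) \<in> rel M" for v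
    using assms(1) that by (auto simp: is_model_def)
  then show ?case
    using Box.IH by (auto simp: rel_image_model[OF assms Box.prems])
qed auto

lemma po_model_image_model:
  assumes M: "po_model M" and inj: "inj_on f (worlds M)"
  shows "po_model (image_model f M)"
proof -
  have sub: "rel M \<subseteq> worlds M \<times> worlds M" and refl: "\<And>x. x \<in> worlds M \<Longrightarrow> (x, x) \<in> rel M"
    and trans: "trans (rel M)" and antisym: "antisym (rel M)"
    using M by (auto simp: po_model_def is_model_def partial_order_on_def preorder_on_def refl_on_def)
  have "trans (rel (image_model f M))"
  proof (rule transI)
    fix x y z assume "(x, y) \<in> rel (image_model f M)" "(y, z) \<in> rel (image_model f M)"
    then obtain a b b' c where *: "(a, b) \<in> rel M" "(b', c) \<in> rel M" "f b = f b'"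
      "x = f a" "z = f c"
      by (auto simp: image_model_def)
    with sub inj have "b = b'" by (blast dest: inj_onD)
    with * transD[OF trans] show "(x, z) \<in> rel (image_model f M)"
      by (force simp: image_model_def)
  qed
  moreover have "antisym (rel (image_model f M))"
  proof (rule antisymI)
    fix x y assume "(x, y) \<in> rel (image_model f M)" "(y, x) \<in> rel (image_model f M)"
    then obtain a b a' b' where *: "(a, b) \<in> rel M" "(b', a') \<in> rel M" "f b = f b'" "f a = f a'"
      "x = f a" "y = f b"
      by (auto simp: image_model_def)
    with sub inj have "b = b'" "a = a'" by (blast dest: inj_onD)+
    with * antisymD[OF antisym] show "x = y" by auto
  qed
  moreover have "refl_on (worlds (image_model f M)) (rel (image_model f M))"
    using refl sub by (auto simp: image_model_def refl_on_def)
  moreover have "is_model (image_model f M)"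
    using M by (auto simp: po_model_def is_model_def image_model_def)
  ultimately show ?thesis
    by (auto simp: po_model_def partial_order_on_def preorder_on_def is_model_def)
qed

section \<open>Bounding the branches\<close>

lemma fms_append: "fms \<rho> (\<Theta> @ [s]) = fms \<rho> \<Theta> \<union> set (snd s)"
  by (auto simp: fms_def)

lemma bnoms_append: "bnoms \<rho> (\<Theta> @ [s]) = bnoms \<rho> \<Theta> \<union> (\<Union>\<phi> \<in> set (snd s). noms \<phi>)"
  by (auto simp: bnoms_def fms_append)

lemma rules_append: "rules (\<Theta> @ [s]) = insert (fst s) (rules \<Theta>)"
  by (auto simp: rules_def)

lemma finite_fms: "finite (fms \<rho> \<Theta>)"
  by (auto simp: fms_def)

lemma finite_bnoms: "finite (bnoms \<rho> \<Theta>)"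
  by (auto simp: bnoms_def finite_fms finite_noms)

lemma noms_fms: "\<phi> \<in> fms \<rho> \<Theta> \<Longrightarrow> noms \<phi> \<subseteq> bnoms \<rho> \<Theta>"
  by (auto simp: bnoms_def)

lemma noms_root_subset: "noms \<rho> \<subseteq> bnoms \<rho> \<Theta>"
  by (rule noms_fms) (simp add: fms_def)

lemma subfms_asym_fm:
  "subfms (asym_fm i) = {asym_fm i, Dis (Nom i) (Box (Neg (Nom i))), Nom i, Box (Neg (Nom i)), Neg (Nom i)}"
  by (auto simp: asym_fm_def)

lemma accessibility_mono: "accessibility \<Theta> \<chi> \<Longrightarrow> accessibility (\<Theta> @ [s]) \<chi>"
  by (auto simp: accessibility_def rules_append)

lemma accessibility_Dia: "accessibility \<Theta> (At i \<psi>) \<Longrightarrow> \<exists>j. \<psi> = Dia (Nom j)"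
  by (auto simp: accessibility_def)

text \<open>The diamond rule alone brings in a nominal or a \<open>DiaR\<close> tag, so invariants
  about nominals need two cases instead of one per rule.\<close>

lemma applies_step_cases:
  assumes "applies \<rho> \<Theta> S" "s \<in> S"
  obtains (Dia) i \<phi> j where "s = (DiaR i \<phi> j, [At i (Dia (Nom j)), At j \<phi>])"
      "At i (Dia \<phi>) \<in> fms \<rho> \<Theta>" "\<not> accessibility \<Theta> (At i (Dia \<phi>))" "\<forall>k. DiaR i \<phi> k \<notin> rules \<Theta>"
      "quasi_urfather \<rho> \<Theta> i" "j \<notin> bnoms \<rho> \<Theta>"
  | (other) "\<And>i \<phi> j. fst s \<noteq> DiaR i \<phi> j" "(\<Union>\<phi> \<in> set (snd s). noms \<phi>) \<subseteq> bnoms \<rho> \<Theta>"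
  using assms(1)
proof cases
  case (Dia i \<phi> j)
  with assms(2) that(1) show thesis by blast
qed (rule that(2); use assms(2) in \<open>auto simp: asym_fm_def dest!: noms_fms\<close>)+

text \<open>Collects the finite branches under all choices of rules, so a bound proved here holds
  for every tableau with root \<open>\<rho>\<close>.\<close>

inductive_set nodes :: "fm \<Rightarrow> step list set" for \<rho> where
  Nil: "[] \<in> nodes \<rho>"
| Snoc: "\<Theta> \<in> nodes \<rho> \<Longrightarrow> extends \<rho> \<Theta> S \<Longrightarrow> s \<in> S \<Longrightarrow> \<Theta> @ [s] \<in> nodes \<rho>"

definition ancestors :: "step list \<Rightarrow> nom \<Rightarrow> nom set" where
  "ancestors \<Theta> i = {j. (j, i) \<in> (intro_rel \<Theta>)\<^sup>*}"

section \<open>Formulas that can occur on a branch\<close>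

locale rooted =
  fixes i\<^sub>0 :: nom and \<phi>\<^sub>0 :: fm
begin

abbreviation "\<rho> \<equiv> At i\<^sub>0 \<phi>\<^sub>0"

definition core :: "step list \<Rightarrow> fm set" where
  "core \<Theta> = subfms \<phi>\<^sub>0 \<union> (\<Union>j \<in> bnoms \<rho> \<Theta>. subfms (asym_fm j))"

lemma core_mono: "\<phi> \<in> core \<Theta> \<Longrightarrow> \<phi> \<in> core (\<Theta> @ [s])"
  by (auto simp: core_def bnoms_append)

lemma core_subfms: "\<phi> \<in> subfms \<psi> \<Longrightarrow> \<psi> \<in> core \<Theta> \<Longrightarrow> \<phi> \<in> core \<Theta>"
  by (auto simp: core_def intro: subfms_trans)

text \<open>\<open>asym_fm j\<close> contains no diamonds. So every diamond to be expanded stems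
  from the root, which keeps the entries of addresses in a finite set.\<close>

lemma Dia_core: "Dia \<phi> \<in> core \<Theta> \<Longrightarrow> Dia \<phi> \<in> subfms \<phi>\<^sub>0"
  by (auto simp: core_def subfms_asym_fm asym_fm_def)

definition fm_shape :: "step list \<Rightarrow> fm \<Rightarrow> bool" where
  "fm_shape \<Theta> \<chi> \<longleftrightarrow> (\<exists>i \<psi>. \<chi> = At i \<psi> \<and> (\<psi> \<in> core \<Theta> \<or> accessibility \<Theta> \<chi>))"

lemma fm_shape_mono: "fm_shape \<Theta> \<chi> \<Longrightarrow> fm_shape (\<Theta> @ [s]) \<chi>"
  unfolding fm_shape_def by (blast intro: accessibility_mono core_mono)

lemma fm_shape_coreD: "fm_shape \<Theta> (At i \<psi>) \<Longrightarrow> \<not> accessibility \<Theta> (At i \<psi>) \<Longrightarrow> \<psi> \<in> core \<Theta>"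
  by (auto simp: fm_shape_def)

text \<open>Conclusions are recorded accessibility formulas, (subformulas of) some
  \<open>asym_fm i\<close>, or subformulas of a premise. Such a premise lies in \<open>core\<close>:
  the diamond rule and \<open>[Id]\<close> exclude accessibility formulas, and the other rules need
  a shape different from \<open>Dia (Nom j)\<close>.\<close>

lemma fm_shape_step:
  assumes shape: "\<And>\<chi>. \<chi> \<in> fms \<rho> \<Theta> \<Longrightarrow> fm_shape \<Theta> \<chi>"
    and "applies \<rho> \<Theta> S" "s \<in> S" "\<chi> \<in> set (snd s)"
  shows "fm_shape (\<Theta> @ [s]) \<chi>"
proof -
  have step: ?thesis if "\<chi> = At j \<psi>" "\<psi> \<in> subfms \<theta>" "At i \<theta> \<in> fms \<rho> \<Theta>"
    "\<not> accessibility \<Theta> (At i \<theta>)" for i j \<psi> \<theta>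
    using that fm_shape_coreD[OF shape] core_subfms core_mono unfolding fm_shape_def by blast
  have compound: "\<not> accessibility \<Theta> (At i \<theta>)" if "\<forall>j. \<theta> \<noteq> Dia (Nom j)" for i \<theta>
    using that accessibility_Dia by blast
  from assms(2) show ?thesis
  proof cases
    case (Eq i)
    then show ?thesis
      using assms(3,4) by (auto simp: fm_shape_def core_def subfms_asym_fm bnoms_append)
  next
    case (Con i \<phi> \<psi>)
    then show ?thesis
      using assms(3,4) step[OF _ _ Con(2)] compound by (auto simp: subfms_refl)
  next
    case (Dis i \<phi> \<psi>)
    then show ?thesis
      using assms(3,4) step[OF _ _ Dis(2)] compound by (auto simp: subfms_refl)
  next
    case (Dia i \<phi> j)
    then consider "\<chi> = At i (Dia (Nom j))" | "\<chi> = At j \<phi>" using assms(3,4) by auto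
    then show ?thesis
    proof cases
      case 1
      then show ?thesis
        using Dia(1) assms(3) by (auto simp: fm_shape_def accessibility_def rules_append)
    next
      case 2
      then show ?thesis by (rule step[OF _ _ Dia(2,3)]) (simp add: subfms_refl)
    qed
  next
    case (Box i \<phi> j)
    then show ?thesis
      using assms(3,4) step[OF _ _ Box(2)] compound by (auto simp: subfms_refl)
  next
    case (At i j \<phi>)
    then show ?thesis
      using assms(3,4) step[OF _ _ At(2)] compound by (auto simp: subfms_refl)
  next
    case (Id i \<phi> j)
    then show ?thesis
      using assms(3,4) step[OF _ _ Id(2,3)] by (auto simp: subfms_refl)
  next
    case (Ref i)
    then show ?thesis
      using assms(3,4) by (auto simp: fm_shape_def accessibility_def rules_append)
  next
    case (Asym i)
    then show ?thesis
      using assms(3,4) by (auto simp: fm_shape_def core_def subfms_asym_fm bnoms_append)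
  next
    case (Trs i \<phi> j)
    then show ?thesis
      using assms(3,4) step[OF _ _ Trs(2)] compound by (auto simp: subfms_refl)
  qed
qed

lemma nodes_fm_shape: "\<Theta> \<in> nodes \<rho> \<Longrightarrow> \<chi> \<in> fms \<rho> \<Theta> \<Longrightarrow> fm_shape \<Theta> \<chi>"
proof (induction arbitrary: \<chi> rule: nodes.induct)
  case Nil
  then show ?case by (auto simp: fms_def fm_shape_def core_def subfms_refl)
next
  case (Snoc \<Theta> S s)
  then show ?case
    using fm_shape_step[of \<Theta> S s \<chi>] fm_shape_mono[of \<Theta> \<chi> s]
    by (auto simp: fms_append extends_def)
qed

section \<open>Twins, ancestors and addresses of nominals\<close>

definition closure :: "fm set" where
  "closure = subfms \<phi>\<^sub>0 \<union> (\<Union>j \<in> noms \<rho>. subfms (asym_fm j))"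

lemma finite_closure: "finite closure"
  by (auto simp: closure_def finite_subfms finite_noms)

text \<open>\<open>prefixed_subfm\<close> compares only the formulas behind the prefixes. In
  contrast to \<open>core\<close>, the set \<open>closure\<close> depends on the root alone and is
  fixed along the branch.\<close>

lemma Tset_eq: "Tset \<rho> \<Theta> i = {\<psi> \<in> closure. At i \<psi> \<in> fms \<rho> \<Theta>}"
  by (auto simp: Tset_def T1_def T2_def prefixed_subfm_def closure_def)

text \<open>With twins excluded among the ancestors, \<open>Tset\<close> is injective there, and its
  values are subsets of the finite \<open>closure\<close>.\<close>

lemma card_ancestors_quasi_urfather:
  assumes "quasi_urfather \<rho> \<Theta> i" "ancestors \<Theta> i \<subseteq> bnoms \<rho> \<Theta>"
  shows "card (ancestors \<Theta> i) \<le> 2 ^ card closure"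
proof -
  have "inj_on (Tset \<rho> \<Theta>) (ancestors \<Theta> i)"
    using assms by (fastforce simp: inj_on_def quasi_urfather_def twins_def ancestors_def)
  moreover have "Tset \<rho> \<Theta> ` ancestors \<Theta> i \<subseteq> Pow closure"
    by (auto simp: Tset_eq)
  ultimately have "card (ancestors \<Theta> i) \<le> card (Pow closure)"
    by (meson card_inj_on_le finite_closure finite_Pow_iff)
  then show ?thesis
    by (simp add: card_Pow finite_closure)
qed

text \<open>A nominal introduced on a branch is addressed by the root nominal it descends from and the
  list of diamonds used on the way. Restriction \<open>(\<D>)\<close> bounds the length of that list.\<close>

definition addresses :: "(nom \<times> fm list) set" where
  "addresses = noms \<rho> \<times> {xs. set xs \<subseteq> subfms \<phi>\<^sub>0 \<and> length xs \<le> 2 ^ card closure}"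

lemma finite_addresses: "finite addresses"
  by (auto simp: addresses_def finite_noms finite_subfms finite_lists_length_le)

text \<open>Injectivity into the finite \<open>addresses\<close> bounds the number of nominals. The
  last clause makes the length of an address the depth of its nominal, so that the bound on the
  ancestors of quasi-urfathers can be used.\<close>

definition addressing :: "step list \<Rightarrow> (nom \<Rightarrow> nom \<times> fm list) \<Rightarrow> bool" where
  "addressing \<Theta> a \<longleftrightarrow> inj_on a (bnoms \<rho> \<Theta>) \<and> a ` bnoms \<rho> \<Theta> \<subseteq> addresses \<and>
     (\<forall>x \<in> noms \<rho>. a x = (x, [])) \<and>
     (\<forall>x \<in> bnoms \<rho> \<Theta> - noms \<rho>. \<exists>i \<phi>. DiaR i \<phi> x \<in> rules \<Theta>) \<and>
     (\<forall>i \<phi> x. DiaR i \<phi> x \<in> rules \<Theta> \<longrightarrow>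
        i \<in> bnoms \<rho> \<Theta> \<and> x \<in> bnoms \<rho> \<Theta> - noms \<rho> \<and> a x = (fst (a i), \<phi> # snd (a i))) \<and>
     (\<forall>x \<in> bnoms \<rho> \<Theta>. card (ancestors \<Theta> x) = Suc (length (snd (a x))))"

lemma addressing_ancestors:
  assumes "addressing \<Theta> a" "x \<in> bnoms \<rho> \<Theta>"
  shows "ancestors \<Theta> x \<subseteq> bnoms \<rho> \<Theta>"
proof
  fix y assume "y \<in> ancestors \<Theta> x"
  then have "(y, x) \<in> (intro_rel \<Theta>)\<^sup>*" by (simp add: ancestors_def)
  then show "y \<in> bnoms \<rho> \<Theta>"
    using assms by (induction rule: converse_rtrancl_induct)
      (auto simp: intro_rel_def addressing_def)
qed

text \<open>Only a diamond step changes anything. Its new nominal gets the address of the parent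
  with the body of the diamond in front.\<close>

lemma addressing_step:
  assumes shape: "\<And>\<chi>. \<chi> \<in> fms \<rho> \<Theta> \<Longrightarrow> fm_shape \<Theta> \<chi>"
    and a: "addressing \<Theta> a" and s: "applies \<rho> \<Theta> S" "s \<in> S"
  shows "\<exists>a'. addressing (\<Theta> @ [s]) a'"
  using s
proof (cases rule: applies_step_cases)
  case other
  then have "bnoms \<rho> (\<Theta> @ [s]) = bnoms \<rho> \<Theta>" by (auto simp: bnoms_append)
  moreover have "DiaR i \<phi> x \<in> rules (\<Theta> @ [s]) \<longleftrightarrow> DiaR i \<phi> x \<in> rules \<Theta>" for i \<phi> x
    using other by (auto simp: rules_append) (metis)
  moreover from this have "ancestors (\<Theta> @ [s]) x = ancestors \<Theta> x" for x
    by (simp add: ancestors_def intro_rel_def)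
  ultimately show ?thesis
    using a unfolding addressing_def by auto
next
  case (Dia i \<phi> j)
  define a' where "a' = a(j := (fst (a i), \<phi> # snd (a i)))"
  have i: "i \<in> bnoms \<rho> \<Theta>" and ij: "i \<noteq> j"
    using Dia by (auto simp: quasi_urfather_def)
  note root = noms_root_subset[of \<rho> \<Theta>]
  have \<phi>: "\<phi> \<in> subfms \<phi>\<^sub>0"
    using fm_shape_coreD[OF shape[OF Dia(2)] Dia(3)] Dia_core subfms_components(3) by blast
  have bn: "bnoms \<rho> (\<Theta> @ [s]) = insert j (bnoms \<rho> \<Theta>)"
    using noms_fms[OF Dia(2)] Dia(1) i by (auto simp: bnoms_append)
  have ru: "rules (\<Theta> @ [s]) = insert (DiaR i \<phi> j) (rules \<Theta>)"
    using Dia(1) by (simp add: rules_append)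
  have dia: "i' \<in> bnoms \<rho> \<Theta> \<and> x \<in> bnoms \<rho> \<Theta> - noms \<rho> \<and> a x = (fst (a i'), \<phi>' # snd (a i'))"
    if "DiaR i' \<phi>' x \<in> rules \<Theta>" for i' \<phi>' x
    using a that by (auto simp: addressing_def)
  \<comment> \<open>Being fresh, \<open>j\<close> is isolated in the old \<open>intro_rel\<close>;
    the new edge attaches it as a leaf below \<open>i\<close>.\<close>
  have src: "(j, x) \<in> (intro_rel \<Theta>)\<^sup>* \<longleftrightarrow> x = j" for x
    using dia Dia(6) by (auto simp: intro_rel_def elim: converse_rtranclE)
  have tgt: "(x, j) \<in> (intro_rel \<Theta>)\<^sup>* \<longleftrightarrow> x = j" for x
    using dia Dia(6) by (auto simp: intro_rel_def elim: rtranclE)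
  have ir: "intro_rel (\<Theta> @ [s]) = insert (i, j) (intro_rel \<Theta>)"
    by (auto simp: intro_rel_def ru)
  have anc: "ancestors (\<Theta> @ [s]) x = (if x = j then insert j (ancestors \<Theta> i) else ancestors \<Theta> x)" for x
    by (auto simp: ancestors_def ir rtrancl_insert src tgt)
  have sub: "ancestors \<Theta> i \<subseteq> bnoms \<rho> \<Theta>"
    using addressing_ancestors[OF a i] .
  have len: "card (ancestors \<Theta> x) = Suc (length (snd (a x)))" if "x \<in> bnoms \<rho> \<Theta>" for x
    using a that by (auto simp: addressing_def)
  have ai: "a i \<in> addresses" using a i by (auto simp: addressing_def)
  \<comment> \<open>The parent counts among its own ancestors, so its list is strictly shorter than
    \<open>2 ^ card closure\<close> and has room for one more entry.\<close>
  have addr: "a' j \<in> addresses"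
    using ai \<phi> len[OF i] card_ancestors_quasi_urfather[OF Dia(5) sub]
    by (auto simp: a'_def addresses_def)
  have inj: "inj_on a (bnoms \<rho> \<Theta>)" using a by (simp add: addressing_def)
  \<comment> \<open>A nominal that already has this address would come from the same diamond at the
    same nominal, but the diamond rule is applied at most once per formula.\<close>
  have new: "a x \<noteq> (fst (a i), \<phi> # snd (a i))" if x: "x \<in> bnoms \<rho> \<Theta>" for x
  proof
    assume eq: "a x = (fst (a i), \<phi> # snd (a i))"
    then have "x \<notin> noms \<rho>" using a by (auto simp: addressing_def)
    then obtain i' \<phi>' where r: "DiaR i' \<phi>' x \<in> rules \<Theta>" using a x unfolding addressing_def by blast
    with dia[OF r] eq have "a i' = a i" "\<phi>' = \<phi>" by (auto simp: prod_eq_iff)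
    with dia[OF r] i inj have "i' = i" by (auto dest: inj_onD)
    with r \<open>\<phi>' = \<phi>\<close> Dia(4) show False by blast
  qed
  have "inj_on a' (bnoms \<rho> (\<Theta> @ [s]))"
    using inj new Dia(6) unfolding bn a'_def inj_on_def by auto metis+
  moreover have "a' ` bnoms \<rho> (\<Theta> @ [s]) \<subseteq> addresses"
    using addr a Dia(6) unfolding bn addressing_def by (auto simp: a'_def)
  moreover have "\<forall>x \<in> noms \<rho>. a' x = (x, [])"
    using a root Dia(6) by (auto simp: addressing_def a'_def)
  moreover have "\<forall>x \<in> bnoms \<rho> (\<Theta> @ [s]) - noms \<rho>. \<exists>i \<phi>. DiaR i \<phi> x \<in> rules (\<Theta> @ [s])"
    using a unfolding addressing_def bn ru by blast
  moreover have "\<forall>i \<phi> x. DiaR i \<phi> x \<in> rules (\<Theta> @ [s]) \<longrightarrow> i \<in> bnoms \<rho> (\<Theta> @ [s]) \<and>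
      x \<in> bnoms \<rho> (\<Theta> @ [s]) - noms \<rho> \<and> a' x = (fst (a' i), \<phi> # snd (a' i))"
  proof (intro allI impI)
    fix i' \<phi>' x assume "DiaR i' \<phi>' x \<in> rules (\<Theta> @ [s])"
    then consider "i' = i" "\<phi>' = \<phi>" "x = j" | "DiaR i' \<phi>' x \<in> rules \<Theta>" by (auto simp: ru)
    then show "i' \<in> bnoms \<rho> (\<Theta> @ [s]) \<and>
      x \<in> bnoms \<rho> (\<Theta> @ [s]) - noms \<rho> \<and> a' x = (fst (a' i'), \<phi>' # snd (a' i'))"
    proof cases
      case 1
      then show ?thesis using i ij root Dia(6) unfolding bn a'_def by auto
    next
      case 2
      from dia[OF 2] Dia(6) show ?thesis unfolding bn a'_def by auto
    qed
  qed
  moreover have "\<forall>x \<in> bnoms \<rho> (\<Theta> @ [s]). card (ancestors (\<Theta> @ [s]) x) = Suc (length (snd (a' x)))"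
  proof -
    have "j \<notin> ancestors \<Theta> i" using sub Dia(6) by auto
    moreover have "finite (ancestors \<Theta> i)" using sub finite_bnoms finite_subset by blast
    ultimately show ?thesis
      using len len[OF i] unfolding bn anc a'_def by auto
  qed
  ultimately show ?thesis unfolding addressing_def by blast
qed

lemma nodes_addressing: "\<Theta> \<in> nodes \<rho> \<Longrightarrow> \<exists>a. addressing \<Theta> a"
proof (induction rule: nodes.induct)
  case Nil
  have "ancestors [] x = {x}" for x
    by (auto simp: ancestors_def intro_rel_def rules_def)
  then have "addressing [] (\<lambda>x. (x, []))"
    by (auto simp: addressing_def inj_on_def addresses_def rules_def bnoms_def fms_def)
  then show ?case by blast
next
  case (Snoc \<Theta> S s)
  then show ?case
    using addressing_step[of \<Theta> _ S s] nodes_fm_shape by (auto simp: extends_def)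
qed

text \<open>Every step adds a formula, so the length stays below the number of formulas. Boundedly
  many nominals allow only boundedly many formulas.\<close>

lemma nodes_length_bounded: "\<exists>K. \<forall>\<Theta> \<in> nodes \<rho>. length \<Theta> \<le> K"
proof -
  define B where "B = card addresses"
  \<comment> \<open>The first factor counts prefixes, the second the formulas behind them:
    subformulas of the root, accessibility formulas, and five subformulas for each
    \<open>asym_fm j\<close>.\<close>
  define K where "K = B * (card (subfms \<phi>\<^sub>0) + B + B * 5)"
  have grow: "length \<Theta> < card (fms \<rho> \<Theta>)" if "\<Theta> \<in> nodes \<rho>" for \<Theta>
    using that
  proof (induction rule: nodes.induct)
    case Nil
    show ?case by (simp add: fms_def)
  next
    case (Snoc \<Theta> S s)
    then have "fms \<rho> \<Theta> \<subset> fms \<rho> (\<Theta> @ [s])"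
      by (auto simp: fms_append extends_def)
    from psubset_card_mono[OF finite_fms this] Snoc.IH show ?case by simp
  qed
  have "card (fms \<rho> \<Theta>) \<le> K" if \<Theta>: "\<Theta> \<in> nodes \<rho>" for \<Theta>
  proof -
    let ?N = "bnoms \<rho> \<Theta>"
    let ?F = "subfms \<phi>\<^sub>0 \<union> (Dia \<circ> Nom) ` ?N \<union> (\<Union>j \<in> ?N. subfms (asym_fm j))"
    obtain a where a: "addressing \<Theta> a" using nodes_addressing[OF \<Theta>] ..
    have N: "card ?N \<le> B"
      using a finite_addresses unfolding addressing_def B_def by (meson card_inj_on_le)
    have "fms \<rho> \<Theta> \<subseteq> (\<lambda>(i, \<psi>). At i \<psi>) ` (?N \<times> ?F)"
    proof
      fix \<chi> assume \<chi>: "\<chi> \<in> fms \<rho> \<Theta>"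
      from nodes_fm_shape[OF \<Theta> \<chi>] obtain i \<psi> where i: "\<chi> = At i \<psi>"
        and "\<psi> \<in> core \<Theta> \<or> accessibility \<Theta> \<chi>"
        by (auto simp: fm_shape_def)
      then have "\<psi> \<in> ?F"
        using noms_fms[OF \<chi>] by (auto simp: core_def dest: accessibility_Dia)
      moreover have "i \<in> ?N" using noms_fms[OF \<chi>] i by simp
      ultimately show "\<chi> \<in> (\<lambda>(i, \<psi>). At i \<psi>) ` (?N \<times> ?F)" using i by blast
    qed
    moreover have finF: "finite ?F" by (simp add: finite_subfms finite_bnoms)
    ultimately have "card (fms \<rho> \<Theta>) \<le> card (?N \<times> ?F)"
      by (meson finite_SigmaI finite_bnoms surj_card_le)
    also have "\<dots> = card ?N * card ?F" by (simp add: card_cartesian_product)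
    also have "\<dots> \<le> K"
    proof -
      have "card ((Dia \<circ> Nom) ` ?N) \<le> B"
        using card_image_le[OF finite_bnoms, of "Dia \<circ> Nom"] N le_trans by blast
      moreover have "card (\<Union>j \<in> ?N. subfms (asym_fm j)) \<le> B * 5"
      proof -
        have "card (\<Union>j \<in> ?N. subfms (asym_fm j)) \<le> (\<Sum>j \<in> ?N. card (subfms (asym_fm j)))"
          by (rule card_UN_le[OF finite_bnoms])
        also have "\<dots> \<le> (\<Sum>j \<in> ?N. 5)"
          by (intro sum_mono) (simp add: subfms_asym_fm card_insert_if)
        also have "\<dots> \<le> B * 5" using N by simp
        finally show ?thesis .
      qed
      ultimately have "card ?F \<le> card (subfms \<phi>\<^sub>0) + B + B * 5"
        by (meson add_mono card_Un_le le_refl le_trans)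
      with N show ?thesis unfolding K_def by (rule mult_le_mono)
    qed
    finally show ?thesis .
  qed
  with grow show ?thesis by (meson less_imp_le_nat le_trans)
qed

end

section \<open>The model of a saturated open branch\<close>

lemma nodes_DiaR:
  "\<Theta> \<in> nodes \<rho> \<Longrightarrow> DiaR i \<phi> k \<in> rules \<Theta> \<Longrightarrow>
     At i (Dia (Nom k)) \<in> fms \<rho> \<Theta> \<and> At k \<phi> \<in> fms \<rho> \<Theta>"
proof (induction rule: nodes.induct)
  case Nil
  then show ?case by (simp add: rules_def)
next
  case (Snoc \<Theta> S s)
  from Snoc.hyps have "applies \<rho> \<Theta> S" "s \<in> S" by (auto simp: extends_def)
  then show ?case
  proof (cases rule: applies_step_cases)
    case (Dia i' \<phi>' j)
    then show ?thesis using Snoc.prems Snoc.IH by (auto simp: rules_append fms_append)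
  next
    case other
    then have "DiaR i \<phi> k \<in> rules \<Theta>" using Snoc.prems by (auto simp: rules_append) (metis)
    then show ?thesis using Snoc.IH by (simp add: fms_append)
  qed
qed

text \<open>\<open>saturated\<close> is what the failure of \<open>extends\<close> says about an
  unclosed branch: one of the resulting branches would gain nothing.\<close>

locale open_branch = rooted +
  fixes \<Theta> :: "step list"
  assumes nnf_root: "is_nnf \<phi>\<^sub>0"
    and node: "\<Theta> \<in> nodes \<rho>"
    and not_clash: "\<not> clash (fms \<rho> \<Theta>)"
    and saturated: "\<And>S. applies \<rho> \<Theta> S \<Longrightarrow> \<exists>s \<in> S. set (snd s) \<subseteq> fms \<rho> \<Theta>"
begin

abbreviation "F \<equiv> fms \<rho> \<Theta>"

section \<open>Saturation conditions, rule by rule\<close>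

lemma nominal_in_bnoms: "At i \<phi> \<in> F \<Longrightarrow> i \<in> bnoms \<rho> \<Theta>"
  using noms_fms by fastforce

lemma F_Eq: "i \<in> bnoms \<rho> \<Theta> \<Longrightarrow> At i (Nom i) \<in> F"
  by (drule saturated[OF applies.Eq]) simp

lemma F_Con: "At i (Con \<phi> \<psi>) \<in> F \<Longrightarrow> At i \<phi> \<in> F \<and> At i \<psi> \<in> F"
  by (drule saturated[OF applies.Con]) simp

lemma F_Dis: "At i (Dis \<phi> \<psi>) \<in> F \<Longrightarrow> At i \<phi> \<in> F \<or> At i \<psi> \<in> F"
  by (drule saturated[OF applies.Dis]) simp

text \<open>Saturation cannot mean here that the conclusions are present, since they contain a fresh
  nominal; hence the rule must have been applied before.\<close>

lemma F_Dia:
  assumes "At i (Dia \<phi>) \<in> F" "\<not> accessibility \<Theta> (At i (Dia \<phi>))" "quasi_urfather \<rho> \<Theta> i"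
  shows "\<exists>k. DiaR i \<phi> k \<in> rules \<Theta>"
proof (rule ccontr)
  assume none: "\<nexists>k. DiaR i \<phi> k \<in> rules \<Theta>"
  obtain j where j: "j \<notin> bnoms \<rho> \<Theta>"
    using ex_new_if_finite[OF infinite_UNIV_nat finite_bnoms] by blast
  from saturated[OF applies.Dia[OF assms(1,2) _ assms(3) j]] none
  have "At j \<phi> \<in> F" by auto
  with j show False by (auto dest: nominal_in_bnoms)
qed

lemma F_Box: "At i (Box \<phi>) \<in> F \<Longrightarrow> At i (Dia (Nom j)) \<in> F \<Longrightarrow> At j \<phi> \<in> F"
  by (drule (1) saturated[OF applies.Box]) simp

lemma F_At: "At i (At j \<phi>) \<in> F \<Longrightarrow> At j \<phi> \<in> F"
  by (drule saturated[OF applies.At]) simp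

lemma F_Id: "At i \<phi> \<in> F \<Longrightarrow> \<not> accessibility \<Theta> (At i \<phi>) \<Longrightarrow> At i (Nom j) \<in> F \<Longrightarrow> At j \<phi> \<in> F"
  by (drule (2) saturated[OF applies.Id]) simp

lemma F_Ref: "i \<in> bnoms \<rho> \<Theta> \<Longrightarrow> At i (Dia (Nom i)) \<in> F"
  by (drule saturated[OF applies.Ref]) simp

lemma F_Asym: "i \<in> bnoms \<rho> \<Theta> \<Longrightarrow> At i (asym_fm i) \<in> F"
  by (drule saturated[OF applies.Asym]) simp

lemma F_Trs: "At i (Box \<phi>) \<in> F \<Longrightarrow> At i (Dia (Nom j)) \<in> F \<Longrightarrow> At j (Box \<phi>) \<in> F"
  by (drule (1) saturated[OF applies.Trs]) simp

text \<open>The address of \<open>k\<close> determines that of its parent, and addresses are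
  injective; hence the uniqueness of the parent in the last claim.\<close>

lemma introduced:
  assumes "DiaR i \<phi> k \<in> rules \<Theta>"
  shows "At i (Dia (Nom k)) \<in> F" "At k \<phi> \<in> F" "k \<notin> noms \<rho>"
    "DiaR i' \<phi>' k \<in> rules \<Theta> \<Longrightarrow> i' = i"
proof -
  show "At i (Dia (Nom k)) \<in> F" "At k \<phi> \<in> F"
    using nodes_DiaR[OF node assms] by auto
  obtain a where a: "addressing \<Theta> a"
    using nodes_addressing[OF node] ..
  then show "k \<notin> noms \<rho>"
    using assms unfolding addressing_def by blast
  show "i' = i" if "DiaR i' \<phi>' k \<in> rules \<Theta>"
  proof -
    have "i \<in> bnoms \<rho> \<Theta>" "i' \<in> bnoms \<rho> \<Theta>" "a k = (fst (a i), \<phi> # snd (a i))"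
      "a k = (fst (a i'), \<phi>' # snd (a i'))" "inj_on a (bnoms \<rho> \<Theta>)"
      using a assms that unfolding addressing_def by blast+
    then show ?thesis by (auto simp: inj_on_def prod_eq_iff)
  qed
qed

text \<open>Formulas of \<open>closure\<close> contain only root nominals, whereas the diamond rule
  yields accessibility formulas with an introduced nominal. Only those of \<open>[Ref]\<close>
  remain.\<close>

lemma accessibility_closure:
  assumes "accessibility \<Theta> (At i \<psi>)" "\<psi> \<in> closure"
  shows "\<psi> = Dia (Nom i)"
proof -
  have "noms \<psi> \<subseteq> noms \<rho>"
    using assms(2) noms_subfms by (fastforce simp: closure_def asym_fm_def)
  then show ?thesis
    using assms(1) introduced(3) by (fastforce simp: accessibility_def)
qed

lemma Nom_closure: "Nom x \<in> closure \<longleftrightarrow> x \<in> noms \<rho>"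
proof
  assume "Nom x \<in> closure"
  then show "x \<in> noms \<rho>"
    using noms_subfms by (fastforce simp: closure_def subfms_asym_fm asym_fm_def)
next
  assume "x \<in> noms \<rho>"
  then show "Nom x \<in> closure"
    by (fastforce simp: closure_def subfms_asym_fm)
qed

section \<open>Types of nominals\<close>

text \<open>\<open>[Id]\<close> does not copy accessibility formulas, so nominals denoting the same world may disagree on
  \<open>Dia (Nom x)\<close> when \<open>x\<close> denotes that world too; \<open>type_of\<close> adds these formulas to make
  the types agree.\<close>

definition type_of :: "nom \<Rightarrow> fm set" where
  "type_of i = Tset \<rho> \<Theta> i \<union> {Dia (Nom x) |x. Nom x \<in> Tset \<rho> \<Theta> i}"

lemma type_ofI: "At i \<psi> \<in> F \<Longrightarrow> \<psi> \<in> closure \<Longrightarrow> \<psi> \<in> type_of i"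
  by (auto simp: type_of_def Tset_eq)

lemma type_ofD: "\<psi> \<in> type_of i \<Longrightarrow> \<forall>x. \<psi> \<noteq> Dia (Nom x) \<Longrightarrow> At i \<psi> \<in> F \<and> \<psi> \<in> closure"
  by (auto simp: type_of_def Tset_eq)

text \<open>\<open>[Id]\<close> copies all but accessibility formulas. The only one of these in
  \<open>closure\<close> is \<open>Dia (Nom i)\<close>, and \<open>type_of j\<close> contains it
  because \<open>[Id]\<close> does copy \<open>Nom i\<close>.\<close>

lemma type_of_mono:
  assumes "At i (Nom j) \<in> F"
  shows "type_of i \<subseteq> type_of j"
proof
  fix \<psi> assume "\<psi> \<in> type_of i"
  have Nom: "Nom x \<in> Tset \<rho> \<Theta> j" if "Nom x \<in> closure" "At i (Nom x) \<in> F" for x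
    using F_Id[OF that(2) _ assms] that(1) by (auto simp: Tset_eq dest: accessibility_Dia)
  from \<open>\<psi> \<in> type_of i\<close> consider "\<psi> \<in> closure" "At i \<psi> \<in> F" "\<not> accessibility \<Theta> (At i \<psi>)"
    | "\<psi> \<in> closure" "accessibility \<Theta> (At i \<psi>)"
    | x where "\<psi> = Dia (Nom x)" "Nom x \<in> Tset \<rho> \<Theta> i"
    by (auto simp: type_of_def Tset_eq)
  then show "\<psi> \<in> type_of j"
  proof cases
    case 1
    with F_Id[OF _ _ assms] type_ofI show ?thesis by blast
  next
    case 2
    then have \<psi>: "\<psi> = Dia (Nom i)" by (rule accessibility_closure[rotated])
    with 2 have "Nom i \<in> closure"
      using noms_subfms by (fastforce simp: Nom_closure closure_def asym_fm_def)
    moreover have "At i (Nom i) \<in> F"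
      using assms by (auto intro: F_Eq nominal_in_bnoms)
    ultimately show ?thesis using Nom \<psi> by (auto simp: type_of_def)
  next
    case 3
    then show ?thesis using Nom by (auto simp: type_of_def Tset_eq)
  qed
qed

lemma type_of_eq:
  assumes "At i (Nom j) \<in> F"
  shows "type_of i = type_of j"
proof -
  have "At i (Nom i) \<in> F"
    using assms by (auto intro: F_Eq nominal_in_bnoms)
  then have "At j (Nom i) \<in> F"
    using F_Id[OF _ _ assms] by (auto dest: accessibility_Dia)
  with assms show ?thesis by (blast dest: type_of_mono)
qed

lemma type_of_Nom: "Nom a \<in> type_of i \<Longrightarrow> type_of i = type_of a"
  using type_ofD[of "Nom a" i] type_of_eq by auto

text \<open>Inclusion of these sets will serve as accessibility between types: \<open>[Trs]\<close>
  yields it along accessibility formulas, and \<open>[Ref]\<close> with \<open>[Box]\<close> puts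
  the boxed formulas into the type itself.\<close>

definition boxes :: "fm set \<Rightarrow> fm set" where
  "boxes t = {\<phi>. Box \<phi> \<in> t}"

lemma boxes_accessible:
  assumes "At i (Dia (Nom j)) \<in> F"
  shows "boxes (type_of i) \<subseteq> boxes (type_of j)"
  using F_Trs[OF _ assms] by (auto simp: boxes_def dest!: type_ofD intro!: type_ofI)

lemma closure_Box: "Box \<phi> \<in> closure \<Longrightarrow> \<phi> \<in> closure"
  by (auto simp: closure_def dest: subfms_components)

lemma closure_Dis: "Dis \<phi> \<psi> \<in> closure \<Longrightarrow> \<phi> \<in> closure \<and> \<psi> \<in> closure"
  by (auto simp: closure_def dest: subfms_components)

lemma boxes_type_of: "\<phi> \<in> boxes (type_of i) \<Longrightarrow> \<phi> \<in> type_of i"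
  using F_Ref[of i] by (auto simp: boxes_def dest!: type_ofD intro!: type_ofI
      intro: F_Box nominal_in_bnoms closure_Box)

text \<open>Restriction \<open>(\<D>)\<close> guarantees expanded diamonds only at
  quasi-urfathers.\<close>

definition types :: "fm set set" where
  "types = type_of ` {i. quasi_urfather \<rho> \<Theta> i}"

definition named :: "fm set \<Rightarrow> bool" where
  "named t \<longleftrightarrow> (\<exists>a. Nom a \<in> t)"

text \<open>Root nominals are never introduced, so each is its own only ancestor. Their types are
  thus available as denotations.\<close>

lemma root_quasi_urfather:
  assumes "a \<in> noms \<rho>"
  shows "quasi_urfather \<rho> \<Theta> a"
proof -
  have "j = a" if "(j, a) \<in> (intro_rel \<Theta>)\<^sup>*" for j
    using that assms introduced(3) by (auto simp: intro_rel_def elim: rtranclE)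
  then show ?thesis
    using assms noms_root_subset[of \<rho> \<Theta>] by (auto simp: quasi_urfather_def)
qed

lemma quasi_urfather_ancestor:
  "quasi_urfather \<rho> \<Theta> i \<Longrightarrow> (j, i) \<in> (intro_rel \<Theta>)\<^sup>* \<Longrightarrow> j \<in> bnoms \<rho> \<Theta> \<Longrightarrow> quasi_urfather \<rho> \<Theta> j"
  unfolding quasi_urfather_def by (meson rtrancl_trans)

text \<open>A successor that is not a quasi-urfather has a twin among the ancestors of its parent;
  the twin, which is a quasi-urfather, provides the type.\<close>

lemma child_type:
  assumes i: "quasi_urfather \<rho> \<Theta> i" and k: "DiaR i \<phi> k \<in> rules \<Theta>"
  shows "type_of k \<in> types"
proof (cases "quasi_urfather \<rho> \<Theta> k")
  case True
  then show ?thesis by (auto simp: types_def)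
next
  case False
  have "k \<in> bnoms \<rho> \<Theta>"
    using introduced(2)[OF k] by (rule nominal_in_bnoms)
  with False obtain j l where jl: "j \<noteq> l" "twins \<rho> \<Theta> j l"
    "(j, k) \<in> (intro_rel \<Theta>)\<^sup>*" "(l, k) \<in> (intro_rel \<Theta>)\<^sup>*"
    by (auto simp: quasi_urfather_def)
  have anc: "x = k \<or> (x, i) \<in> (intro_rel \<Theta>)\<^sup>*" if "(x, k) \<in> (intro_rel \<Theta>)\<^sup>*" for x
    using that introduced(4)[OF k] by (auto simp: intro_rel_def elim: rtranclE)
  \<comment> \<open>The ancestors of \<open>i\<close> contain no twins, so one of \<open>j\<close>
    and \<open>l\<close> is \<open>k\<close> itself and the other is the desired
    \<open>x\<close>.\<close>
  obtain x where x: "(x, i) \<in> (intro_rel \<Theta>)\<^sup>*" "twins \<rho> \<Theta> x k"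
    using anc[OF jl(3)] anc[OF jl(4)] jl i by (auto simp: quasi_urfather_def twins_def)
  then have "quasi_urfather \<rho> \<Theta> x" "type_of x = type_of k"
    using quasi_urfather_ancestor[OF i] by (auto simp: twins_def type_of_def)
  then show ?thesis unfolding types_def by (metis imageI mem_Collect_eq)
qed

text \<open>A diamond added by \<open>type_of\<close>, or one that is an accessibility formula, is
  witnessed by \<open>t\<close> itself. Any other has been expanded at the quasi-urfather, and
  \<open>child_type\<close> supplies the witness.\<close>

lemma types_Dia:
  assumes t: "t \<in> types" and \<phi>: "Dia \<phi> \<in> t" "Dia \<phi> \<in> subfms \<phi>\<^sub>0"
  shows "\<exists>t' \<in> types. boxes t \<subseteq> boxes t' \<and> \<phi> \<in> t'"
proof -
  obtain i where i: "quasi_urfather \<rho> \<Theta> i" "t = type_of i"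
    using t by (auto simp: types_def)
  have ib: "i \<in> bnoms \<rho> \<Theta>" using i by (simp add: quasi_urfather_def)
  have cl: "\<phi> \<in> closure" "Dia \<phi> \<in> closure"
    using \<phi>(2) by (auto simp: closure_def dest: subfms_components)
  consider x where "\<phi> = Nom x" "Nom x \<in> t" | "At i (Dia \<phi>) \<in> F"
    using \<phi>(1) i(2) by (auto simp: type_of_def Tset_eq)
  then show ?thesis
  proof cases
    case 1
    with t show ?thesis by blast
  next
    case 2
    show ?thesis
    proof (cases "accessibility \<Theta> (At i (Dia \<phi>))")
      case True
      then have "\<phi> = Nom i" using accessibility_closure[OF True cl(2)] by simp
      then have "\<phi> \<in> t" using F_Eq[OF ib] cl(1) i(2) by (auto intro: type_ofI)
      with t show ?thesis by blast
    next
      case False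
      from F_Dia[OF 2 False i(1)] obtain k where k: "DiaR i \<phi> k \<in> rules \<Theta>" ..
      with child_type[OF i(1) k] boxes_accessible introduced[OF k] i(2) cl(1) type_ofI
      show ?thesis by blast
    qed
  qed
qed

text \<open>This is where \<open>[A-sym]\<close> enters: a world denoted by a root nominal lies on no proper cycle.\<close>

lemma named_cluster:
  assumes t: "t \<in> types" "t' \<in> types" "named t" "boxes t = boxes t'"
  shows "t = t'"
proof -
  obtain i j where i: "t = type_of i" "i \<in> bnoms \<rho> \<Theta>" and j: "t' = type_of j" "j \<in> bnoms \<rho> \<Theta>"
    using t by (auto simp: types_def quasi_urfather_def)
  obtain a where a: "Nom a \<in> t" using t(3) by (auto simp: named_def)
  then have ia: "At i (Nom a) \<in> F" "a \<in> noms \<rho>"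
    using i type_ofD[of "Nom a" i] by (auto simp: Nom_closure simp del: noms.simps)
  then have ta: "t = type_of a" using i type_of_eq by simp
  have acl: "asym_fm a \<in> closure" unfolding closure_def using ia(2) subfms_refl by blast
  have "a \<in> bnoms \<rho> \<Theta>" using ia(2) noms_root_subset by blast
  then have "asym_fm a \<in> t" using acl ta F_Asym by (auto intro: type_ofI)
  \<comment> \<open>Equal boxes carry the body of \<open>asym_fm a\<close> over to
    \<open>t'\<close>; by reflexivity it also belongs to that type and can be split.\<close>
  then have "Dis (Nom a) (Box (Neg (Nom a))) \<in> boxes t'"
    unfolding t(4)[symmetric] by (simp add: boxes_def asym_fm_def)
  then have "Dis (Nom a) (Box (Neg (Nom a))) \<in> type_of j"
    using j boxes_type_of by simp
  then consider "At j (Nom a) \<in> F" | "At j (Box (Neg (Nom a))) \<in> F" "Box (Neg (Nom a)) \<in> closure"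
    using closure_Dis F_Dis type_ofD by blast
  then show ?thesis
  proof cases
    case 1
    then show ?thesis using ta j type_of_eq by simp
  next
    case 2
    \<comment> \<open>The second disjunct returns to \<open>t\<close> through the equal boxes and,
      by reflexivity, clashes with \<open>Nom a\<close> there.\<close>
    then have "Neg (Nom a) \<in> boxes t"
      using j type_ofI unfolding t(4) by (simp add: boxes_def)
    then have "At i (Neg (Nom a)) \<in> F"
      using i boxes_type_of type_ofD[of "Neg (Nom a)" i] by simp
    with ia(1) not_clash show ?thesis
      unfolding clash_def by (metis nnf.simps(9))
  qed
qed

section \<open>The refuting model\<close>

text \<open>Clusters of unnamed types are unravelled along the natural numbers. The resulting infinity
  cannot be avoided: \<open>\<box>\<diamond>p \<and> \<box>\<diamond>\<not>p\<close> has PO models, but no finite ones.\<close>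

definition Ws :: "(fm set \<times> nat) set" where
  "Ws = {(t, m). t \<in> types \<and> (named t \<longrightarrow> m = 0)}"

text \<open>Box inclusion is only a preorder on types. Demanding a growing index within a cluster,
  that is among types with equal boxes, makes it antisymmetric.\<close>

definition below :: "fm set \<times> nat \<Rightarrow> fm set \<times> nat \<Rightarrow> bool" where
  "below x y \<longleftrightarrow> boxes (fst x) \<subseteq> boxes (fst y) \<and>
     (boxes (fst y) \<subseteq> boxes (fst x) \<longrightarrow> x = y \<or> snd x < snd y)"

text \<open>\<open>den\<close> must be total: nominals outside the root share the world of
  \<open>i\<^sub>0\<close>. A root nominal's type is named by \<open>[Eq]\<close>, so
  \<open>0\<close> is its only index.\<close>

definition M :: "(fm set \<times> nat) model" where
  "M = \<lparr>worlds = Ws, rel = {(x, y). x \<in> Ws \<and> y \<in> Ws \<and> below x y},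
     val = (\<lambda>p. {x \<in> Ws. Pro p \<in> fst x}),
     den = (\<lambda>a. (type_of (if a \<in> noms \<rho> then a else i\<^sub>0), 0))\<rparr>"

lemma root_type_Ws: "a \<in> noms \<rho> \<Longrightarrow> (type_of a, 0) \<in> Ws"
  using root_quasi_urfather by (auto simp: Ws_def types_def simp del: noms.simps)

lemma po_model_M: "po_model M"
proof -
  have "is_model M"
    using root_type_Ws[of i\<^sub>0] root_type_Ws
    by (auto simp: is_model_def M_def simp del: noms.simps(1-7))
  moreover have "refl_on Ws (rel M)"
    by (auto simp: M_def refl_on_def below_def)
  moreover have "trans (rel M)"
  proof (rule transI)
    fix x y z assume "(x, y) \<in> rel M" "(y, z) \<in> rel M"
    then have W: "x \<in> Ws" "z \<in> Ws" and xy: "below x y" and yz: "below y z"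
      by (auto simp: M_def)
    \<comment> \<open>If \<open>z\<close> leads back to \<open>x\<close>, all three lie in one
      cluster, where the indices decide.\<close>
    have "x = z \<or> snd x < snd z" if "boxes (fst z) \<subseteq> boxes (fst x)"
    proof -
      have "x = y \<or> snd x < snd y" "y = z \<or> snd y < snd z"
        using that xy yz unfolding below_def by blast+
      then show ?thesis by auto
    qed
    then show "(x, z) \<in> rel M"
      using W xy yz by (auto simp: M_def below_def)
  qed
  moreover have "antisym (rel M)"
    by (rule antisymI) (auto simp: M_def below_def)
  ultimately show ?thesis
    by (auto simp: po_model_def is_model_def partial_order_on_def preorder_on_def M_def)
qed

text \<open>An unnamed witness is taken at index \<open>Suc m\<close>, above \<open>(t, m)\<close>
  even within the same cluster. A named one has only index \<open>0\<close>; it lies in a strictly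
  higher cluster or, by \<open>named_cluster\<close>, equals \<open>t\<close>.\<close>

lemma M_Dia:
  assumes x: "(t, m) \<in> Ws" and \<phi>: "Dia \<phi> \<in> t" "Dia \<phi> \<in> subfms \<phi>\<^sub>0"
  shows "\<exists>t' m'. ((t, m), (t', m')) \<in> rel M \<and> \<phi> \<in> t'"
proof -
  have t: "t \<in> types" using x by (simp add: Ws_def)
  obtain t' where t': "t' \<in> types" "boxes t \<subseteq> boxes t'" "\<phi> \<in> t'"
    using types_Dia[OF t \<phi>] by blast
  show ?thesis
  proof (cases "named t'")
    case False
    then have "((t, m), (t', Suc m)) \<in> rel M"
      using x t' by (auto simp: M_def Ws_def below_def)
    with t' show ?thesis by blast
  next
    case True
    show ?thesis
    proof (cases "boxes t' \<subseteq> boxes t")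
      case False
      then have "((t, m), (t', 0)) \<in> rel M"
        using x t' by (auto simp: M_def Ws_def below_def)
      with t' show ?thesis by blast
    next
      case True
      with \<open>named t'\<close> t t' have "t' = t" using named_cluster[of t' t] by blast
      moreover have "((t, m), (t, m)) \<in> rel M"
        using x by (auto simp: M_def below_def)
      ultimately show ?thesis using t' by blast
    qed
  qed
qed

text \<open>In negation normal form it suffices that membership implies truth: openness of the
  branch settles negated atoms, \<open>below\<close> passes boxes on, and \<open>M_Dia\<close>
  provides for diamonds.\<close>

lemma truth: "(t, m) \<in> Ws \<Longrightarrow> \<psi> \<in> t \<Longrightarrow> \<psi> \<in> subfms \<phi>\<^sub>0 \<Longrightarrow> sat M (t, m) \<psi>"
proof (induction \<psi> arbitrary: t m)
  case (Pro p)
  then show ?case by (simp add: M_def)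
next
  case (Nom a)
  then obtain i where "t = type_of i" by (auto simp: Ws_def types_def)
  then have "t = type_of a" using type_of_Nom Nom.prems by blast
  moreover have "m = 0" using Nom.prems by (auto simp: Ws_def named_def)
  moreover have "a \<in> noms \<rho>" using noms_subfms[OF Nom.prems(3)] by simp
  ultimately show ?case by (simp add: M_def)
next
  case (Neg \<psi>)
  obtain i where i: "t = type_of i" using Neg.prems by (auto simp: Ws_def types_def)
  have F: "At i (Neg \<psi>) \<in> F" using type_ofD[of "Neg \<psi>" i] Neg.prems i by simp
  have "is_nnf (Neg \<psi>)" using is_nnf_subfms[OF Neg.prems(3) nnf_root] .
  then consider p where "\<psi> = Pro p" | a where "\<psi> = Nom a" by auto
  then have not_in: "\<psi> \<notin> t"
  proof cases
    case 1
    then show ?thesis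
      using F not_clash i type_ofD[of \<psi> i] unfolding clash_def by fastforce
  next
    case 2
    then show ?thesis
      using F not_clash i type_ofD[of \<psi> i] unfolding clash_def by fastforce
  qed
  show ?case
  proof (cases \<psi>)
    case (Nom a)
    then have a: "a \<in> noms \<rho>" using noms_subfms[OF Neg.prems(3)] by simp
    then have "a \<in> bnoms \<rho> \<Theta>" using noms_root_subset by blast
    then have "Nom a \<in> type_of a" using a F_Eq Nom_closure by (blast intro: type_ofI)
    then show ?thesis using a not_in Nom by (auto simp: M_def)
  qed (use not_in \<open>is_nnf (Neg \<psi>)\<close> in \<open>auto simp: M_def\<close>)
next
  case (Con \<psi>\<^sub>1 \<psi>\<^sub>2)
  obtain i where i: "t = type_of i" using Con.prems by (auto simp: Ws_def types_def)
  have sub: "\<psi>\<^sub>1 \<in> subfms \<phi>\<^sub>0" "\<psi>\<^sub>2 \<in> subfms \<phi>\<^sub>0" using Con.prems(3) subfms_components(1) by blast+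
  have "At i \<psi>\<^sub>1 \<in> F" "At i \<psi>\<^sub>2 \<in> F" using type_ofD[of _ i] F_Con Con.prems(2) i by blast+
  then have "\<psi>\<^sub>1 \<in> t" "\<psi>\<^sub>2 \<in> t" using i sub type_ofI by (auto simp: closure_def)
  then show ?case using Con.IH Con.prems(1) sub by simp
next
  case (Dis \<psi>\<^sub>1 \<psi>\<^sub>2)
  obtain i where i: "t = type_of i" using Dis.prems by (auto simp: Ws_def types_def)
  have sub: "\<psi>\<^sub>1 \<in> subfms \<phi>\<^sub>0" "\<psi>\<^sub>2 \<in> subfms \<phi>\<^sub>0" using Dis.prems(3) subfms_components(2) by blast+
  have "At i \<psi>\<^sub>1 \<in> F \<or> At i \<psi>\<^sub>2 \<in> F" using type_ofD[of _ i] F_Dis Dis.prems(2) i by blast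
  then have "\<psi>\<^sub>1 \<in> t \<or> \<psi>\<^sub>2 \<in> t" using i sub type_ofI by (auto simp: closure_def)
  then show ?case using Dis.IH Dis.prems(1) sub by auto
next
  case (Dia \<psi>)
  obtain t' m' where t': "((t, m), (t', m')) \<in> rel M" "\<psi> \<in> t'"
    using M_Dia[OF Dia.prems] by blast
  then have "(t', m') \<in> Ws" by (simp add: M_def)
  then have "sat M (t', m') \<psi>"
    using Dia.IH t'(2) Dia.prems(3) subfms_components(3) by blast
  with t'(1) show ?case by auto
next
  case (Box \<psi>)
  have "sat M (t', m') \<psi>" if "((t, m), (t', m')) \<in> rel M" for t' m'
  proof -
    have t': "(t', m') \<in> Ws" "boxes t \<subseteq> boxes t'"
      using that by (auto simp: M_def below_def)
    then have "\<psi> \<in> boxes t'" using Box.prems(2) by (auto simp: boxes_def)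
    then have "\<psi> \<in> t'" using t'(1) boxes_type_of by (auto simp: Ws_def types_def)
    then show ?thesis using Box.IH t'(1) Box.prems(3) subfms_components(4) by blast
  qed
  then show ?case by auto
next
  case (At a \<psi>)
  obtain i where i: "t = type_of i" using At.prems by (auto simp: Ws_def types_def)
  have sub: "\<psi> \<in> subfms \<phi>\<^sub>0" using At.prems(3) subfms_components(5) by blast
  have a: "a \<in> noms \<rho>" using noms_subfms[OF At.prems(3)] by simp
  have "At a \<psi> \<in> F" using type_ofD[of _ i] F_At At.prems(2) i by blast
  then have "\<psi> \<in> type_of a" using sub type_ofI by (auto simp: closure_def)
  then have "sat M (type_of a, 0) \<psi>" using At.IH root_type_Ws[OF a] sub by blast
  then show ?case using a by (simp add: M_def)
qed

lemma root_satisfiable: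
  "countable (worlds M)" "\<exists>w \<in> worlds M. sat M w \<phi>\<^sub>0"
proof -
  have "countable types" unfolding types_def by (rule countable_image) simp
  then have "countable (types \<times> (UNIV :: nat set))" by simp
  moreover have "Ws \<subseteq> types \<times> UNIV" by (auto simp: Ws_def)
  ultimately show "countable (worlds M)"
    by (auto simp: M_def intro: countable_subset)
  have "\<phi>\<^sub>0 \<in> type_of i\<^sub>0"
    by (rule type_ofI) (auto simp: fms_def closure_def subfms_refl)
  then show "\<exists>w \<in> worlds M. sat M w \<phi>\<^sub>0"
    using truth[of "type_of i\<^sub>0" 0 \<phi>\<^sub>0] root_type_Ws[of i\<^sub>0] by (auto simp: M_def subfms_refl)
qed

end

section \<open>Completeness\<close>

text \<open>Any applicable step will do at each node: branches are finite, and a node that cannot be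
  extended is closed or saturated.\<close>

definition choice :: "fm \<Rightarrow> step list \<Rightarrow> step set" where
  "choice \<rho> \<Theta> = (if \<exists>S. extends \<rho> \<Theta> S then SOME S. extends \<rho> \<Theta> S else {})"

inductive_set choice_tableau :: "fm \<Rightarrow> step list set" for \<rho> where
  Nil: "[] \<in> choice_tableau \<rho>"
| Snoc: "\<Theta> \<in> choice_tableau \<rho> \<Longrightarrow> s \<in> choice \<rho> \<Theta> \<Longrightarrow> \<Theta> @ [s] \<in> choice_tableau \<rho>"

lemma choice_tableau_snoc:
  "\<Theta> @ [s] \<in> choice_tableau \<rho> \<longleftrightarrow> \<Theta> \<in> choice_tableau \<rho> \<and> s \<in> choice \<rho> \<Theta>"
  by (auto intro: choice_tableau.intros elim: choice_tableau.cases)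

lemma choice_extends: "extends \<rho> \<Theta> S \<Longrightarrow> extends \<rho> \<Theta> (choice \<rho> \<Theta>)"
  unfolding choice_def by (auto intro: someI)

lemma choice_empty_or_extends: "choice \<rho> \<Theta> = {} \<or> extends \<rho> \<Theta> (choice \<rho> \<Theta>)"
  by (cases "\<exists>S. extends \<rho> \<Theta> S") (metis choice_extends, simp add: choice_def)

lemma choice_tableau_subset: "\<Theta> \<in> choice_tableau \<rho> \<Longrightarrow> \<Theta> \<in> nodes \<rho>"
proof (induction rule: choice_tableau.induct)
  case (Snoc \<Theta> s)
  then show ?case
    using choice_empty_or_extends[of \<rho> \<Theta>] by (auto intro: nodes.Snoc)
qed (rule nodes.Nil)

lemma choice_nonempty: "extends \<rho> \<Theta> S \<Longrightarrow> choice \<rho> \<Theta> \<noteq> {}"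
  using choice_extends[of \<rho> \<Theta> S] by (auto simp: extends_def elim: applies.cases)

lemma tableau_choice_tableau: "i \<notin> noms \<phi> \<Longrightarrow> tableau (At i \<phi>) (choice_tableau (At i \<phi>))"
  unfolding tableau_def choice_tableau_snoc
  using choice_empty_or_extends by (simp add: choice_tableau.Nil)

text \<open>A maximal chain of bounded length has a longest element, of which all others are
  prefixes; an extension of it would enlarge the chain.\<close>

lemma maxchain_leaf:
  assumes B: "pred_on.maxchain (choice_tableau \<rho>) strict_prefix B"
    and bound: "\<forall>\<Theta> \<in> choice_tableau \<rho>. length \<Theta> \<le> K"
  obtains \<Theta> where "\<Theta> \<in> B" "\<Theta> \<in> choice_tableau \<rho>" "\<And>S. \<not> extends \<rho> \<Theta> S"
proof -
  interpret pred_on "choice_tableau \<rho>" strict_prefix .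
  have ch: "B \<subseteq> choice_tableau \<rho>" "\<And>x y. x \<in> B \<Longrightarrow> y \<in> B \<Longrightarrow> prefix x y \<or> prefix y x"
    using B unfolding maxchain_def chain_def by (auto simp: strict_prefix_def)
  have max: "x \<in> B" if "x \<in> choice_tableau \<rho>" "\<And>y. y \<in> B \<Longrightarrow> prefix y x" for x
  proof (rule ccontr)
    assume "x \<notin> B"
    with that have "\<And>y. y \<in> B \<Longrightarrow> strict_prefix y x" by (auto simp: strict_prefix_def)
    then have "chain (insert x B)" "B \<subset> insert x B"
      using B that \<open>x \<notin> B\<close> unfolding maxchain_def chain_def by auto
    with B show False unfolding maxchain_def by blast
  qed
  have "[] \<in> B"
  proof (cases "B = {}")
    case True
    then show ?thesis using max[OF choice_tableau.Nil] by blast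
  next
    case False
    show ?thesis
    proof (rule ccontr)
      assume "[] \<notin> B"
      then have "\<And>y. y \<in> B \<Longrightarrow> strict_prefix [] y" by (auto simp: strict_prefix_def)
      then have "chain (insert [] B)" "B \<subset> insert [] B"
        using B \<open>[] \<notin> B\<close> choice_tableau.Nil unfolding maxchain_def chain_def by auto
      with B show False unfolding maxchain_def by blast
    qed
  qed
  then obtain \<Theta> where \<Theta>: "\<Theta> \<in> B" "\<And>y. y \<in> B \<Longrightarrow> length y \<le> length \<Theta>"
    using ex_has_greatest_nat[of "\<lambda>x. x \<in> B" "[]" length "Suc K"] ch(1) bound
    by (metis le_imp_less_Suc less_imp_le_nat subsetD)
  have pre: "prefix y \<Theta>" if "y \<in> B" for y
    using ch(2)[OF that \<Theta>(1)] \<Theta>(2)[OF that] by (metis order_antisym prefix_length_le prefix_length_prefix prefix_order.order_refl)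
  have "\<not> extends \<rho> \<Theta> S" for S
  proof
    assume "extends \<rho> \<Theta> S"
    then obtain s where "s \<in> choice \<rho> \<Theta>" using choice_nonempty by blast
    then have "\<Theta> @ [s] \<in> choice_tableau \<rho>" using \<Theta>(1) ch(1) choice_tableau_snoc by blast
    then have "\<Theta> @ [s] \<in> B" using max pre by (simp add: prefix_def) (metis append.assoc prefix_def)
    then show False using \<Theta>(2) by fastforce
  qed
  with \<Theta>(1) ch(1) that show thesis by blast
qed

text \<open>The refuting model is countable but possibly infinite, so an infinite \<open>'w\<close>
  has room for a copy of it.\<close>

theorem theorem5p12:
  fixes \<phi> :: fm
  assumes univ: "infinite (UNIV :: 'w set)"
    and valid: "po_valid TYPE('w) \<phi>"
  shows "provable \<phi>"
proof -
  obtain i where i: "i \<notin> noms \<phi>"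
    using ex_new_if_finite[OF infinite_UNIV_nat finite_noms] by blast
  define \<psi> where "\<psi> = nnf (Neg \<phi>)"
  have i\<psi>: "i \<notin> noms \<psi>" using i by (simp add: \<psi>_def noms_nnf)
  let ?\<T> = "choice_tableau (At i \<psi>)"
  have "clash (\<Union>\<Theta> \<in> B. fms (At i \<psi>) \<Theta>)" if B: "pred_on.maxchain ?\<T> strict_prefix B" for B
  proof (rule ccontr)
    assume no_clash: "\<not> clash (\<Union>\<Theta> \<in> B. fms (At i \<psi>) \<Theta>)"
    obtain K where "\<forall>\<Theta> \<in> ?\<T>. length \<Theta> \<le> K"
      using rooted.nodes_length_bounded[of i \<psi>] choice_tableau_subset by blast
    from maxchain_leaf[OF B this] obtain \<Theta> where \<Theta>: "\<Theta> \<in> B" "\<Theta> \<in> ?\<T>"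
      "\<And>S. \<not> extends (At i \<psi>) \<Theta> S" by blast
    have "\<not> clash (fms (At i \<psi>) \<Theta>)"
      using no_clash \<Theta>(1) unfolding clash_def by blast
    then interpret open_branch i \<psi> \<Theta>
      using \<Theta> choice_tableau_subset is_nnf_nnf
      by unfold_locales (auto simp: extends_def \<psi>_def)
    obtain g :: "nat \<Rightarrow> 'w" where g: "inj g"
      using univ infinite_countable_subset by blast
    define f where "f = g \<circ> to_nat_on (worlds M)"
    have f: "inj_on f (worlds M)"
      unfolding f_def using root_satisfiable(1) g
      by (intro comp_inj_on inj_on_to_nat_on) (auto intro: inj_on_subset)
    obtain w where w: "w \<in> worlds M" "sat M w \<psi>" using root_satisfiable(2) by blast
    have "is_model M" using po_model_M by (simp add: po_model_def)
    from sat_image_model[OF this f w(1)] w(2) have "\<not> sat (image_model f M) (f w) \<phi>"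
      by (simp add: \<psi>_def sat_nnf)
    moreover have "f w \<in> worlds (image_model f M)" using w(1) by (simp add: image_model_def)
    ultimately show False
      using valid po_model_image_model[OF po_model_M f] unfolding po_valid_def by blast
  qed
  with tableau_choice_tableau[OF i\<psi>] i show ?thesis
    unfolding provable_def closed_tableau_def \<psi>_def by blast
qed

end
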